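(* Let $A$ be a unital algebra over an infinite field, and let $n\geq 3$. Then every upper triangular matrix in $M_n(A)$ is the product of two commutators in $M_n(A)$, and every lower triangular matrix in $M_n(A)$ is the product of two commutators in $M_n(A)$.
   Context: Algebras are associative and not necessarily commutative. The commutator of $x,y$ in a ring is the additive commutator $[x,y]=xy-yx$. *)

theory Defs
  imports "Jordan_Normal_Form.Matrix"
begin

(* The sort {ring, monoid_mult} is that of associative unital rings, not necessarily
   commutative; unlike ring_1 it does not impose 0 \<noteq> 1, so the zero algebra is included. *)
locale unital_algebra = vector_space scale
  for scale :: "'k::field \<Rightarrow> 'a::{ring, monoid_mult} \<Rightarrow> 'a" +
  assumes scale_mult_left: "scale c x * y = scale c (x * y)"
    and scale_mult_right: "x * scale c y = scale c (x * y)"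

definition lower_triangular :: "'a::zero mat \<Rightarrow> bool" where
  "lower_triangular T \<longleftrightarrow> (\<forall>i < dim_row T. \<forall>j < dim_col T. i < j \<longrightarrow> T $$ (i, j) = 0)"

definition mat_commutator :: "'a::ring mat \<Rightarrow> 'a mat \<Rightarrow> 'a mat" where
  "mat_commutator X Y = X * Y - Y * X"

definition is_commutator :: "nat \<Rightarrow> 'a::ring mat \<Rightarrow> bool" where
  "is_commutator n C \<longleftrightarrow>
    (\<exists>X \<in> carrier_mat n n. \<exists>Y \<in> carrier_mat n n. C = mat_commutator X Y)"

definition product_of_two_commutators :: "nat \<Rightarrow> 'a::ring mat \<Rightarrow> bool" where
  "product_of_two_commutators n T \<longleftrightarrow>
    (\<exists>C D. is_commutator n C \<and> is_commutator n D \<and> T = C * D)"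

end

(* A matrix Z with zero diagonal is a commutator [X, Y], where X is diagonal with distinct
   scalars x_i on the diagonal and Y_ij = Z_ij / (x_i - x_j) for i \<noteq> j.  It therefore suffices to
   factor a triangular matrix into two matrices with zero diagonal.  For T upper triangular
   one would like to take a cyclic permutation matrix times T with its rows cyclically shifted; the
   only nonzero diagonal entry of the latter is T_1n.  To repair this, row n of T is factored
   as t_nn times the unit row e_n, and the row e_n thus freed in the second factor is reused to
   supply T_1n.  For n = 3 the factorization reads

     (t11 t12 t13)   (0  t13  1)   (0    t22  t23)
     (0   t22 t23) = (1   0   0) * (0     0    1 )
     (0    0  t33)   (0  t33  0)   (t11  t12   0 )

   Lower triangular matrices follow by reversing the order of the basis. *)
theory Submission
  imports Defs
begin

definition zero_diagonal :: "'a::zero mat \<Rightarrow> bool" where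
  "zero_diagonal A \<longleftrightarrow> (\<forall>i < dim_row A. A $$ (i, i) = 0)"

text \<open>For square matrices this is conjugation by the antidiagonal permutation matrix.\<close>

definition rev_mat :: "'a mat \<Rightarrow> 'a mat" where
  "rev_mat A = mat (dim_row A) (dim_col A) (\<lambda>(i, j). A $$ (dim_row A - Suc i, dim_col A - Suc j))"

lemma rev_mat_carrier [simp]: "A \<in> carrier_mat m n \<Longrightarrow> rev_mat A \<in> carrier_mat m n"
  by (auto simp: rev_mat_def)

lemma rev_mat_rev_mat [simp]: "rev_mat (rev_mat A) = A"
  by (rule eq_matI) (auto simp: rev_mat_def Suc_diff_Suc)

lemma index_mult_mat_sum:
  fixes A B :: "'a::semiring_0 mat"
  assumes "A \<in> carrier_mat m n" "B \<in> carrier_mat n p" "i < m" "j < p"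
  shows "(A * B) $$ (i, j) = (\<Sum>k<n. A $$ (i, k) * B $$ (k, j))"
  using assms by (auto simp: scalar_prod_def atLeast0LessThan intro!: sum.cong)

text \<open>The summation index can be reversed along with the outer indices, by
  \<open>k \<mapsto> n - Suc k\<close>.\<close>

lemma rev_mat_mult:
  fixes A B :: "'a::semiring_0 mat"
  assumes A: "A \<in> carrier_mat m n" and B: "B \<in> carrier_mat n p"
  shows "rev_mat (A * B) = rev_mat A * rev_mat B"
proof (rule eq_matI)
  fix i j assume "i < dim_row (rev_mat A * rev_mat B)" "j < dim_col (rev_mat A * rev_mat B)"
  with A B have ij: "i < m" "j < p" by (auto simp: rev_mat_def)
  have "rev_mat (A * B) $$ (i, j) = (A * B) $$ (m - Suc i, p - Suc j)"
    using A B ij by (simp add: rev_mat_def del: index_mult_mat(1))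
  also have "\<dots> = (\<Sum>k<n. A $$ (m - Suc i, k) * B $$ (k, p - Suc j))"
    using A B ij by (simp add: index_mult_mat_sum del: index_mult_mat(1))
  also have "\<dots> = (\<Sum>k<n. A $$ (m - Suc i, n - Suc k) * B $$ (n - Suc k, p - Suc j))"
    by (rule sum.nat_diff_reindex [symmetric])
  also have "\<dots> = (\<Sum>k<n. rev_mat A $$ (i, k) * rev_mat B $$ (k, j))"
    using A B ij by (intro sum.cong) (auto simp: rev_mat_def)
  also have "\<dots> = (rev_mat A * rev_mat B) $$ (i, j)"
    using A B ij by (simp add: index_mult_mat_sum[of _ m n _ p] del: index_mult_mat(1))
  finally show "rev_mat (A * B) $$ (i, j) = (rev_mat A * rev_mat B) $$ (i, j)" .
qed (use A B in \<open>auto simp: rev_mat_def\<close>)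

lemma zero_diagonal_rev_mat:
  assumes "A \<in> carrier_mat n n" "zero_diagonal A"
  shows "zero_diagonal (rev_mat A)"
  using assms by (auto simp: zero_diagonal_def rev_mat_def)

lemma upper_triangular_rev_mat:
  assumes "A \<in> carrier_mat n n" "lower_triangular A"
  shows "upper_triangular (rev_mat A)"
  using assms by (auto simp: lower_triangular_def rev_mat_def)

lemma is_commutator_zero_diagonal:
  fixes scale :: "'k::field \<Rightarrow> 'a::{ring, monoid_mult} \<Rightarrow> 'a"
    and Z :: "'a mat"
  assumes "unital_algebra scale"
    and inf: "infinite (UNIV :: 'k set)"
    and Z: "Z \<in> carrier_mat n n" "zero_diagonal Z"
  shows "is_commutator n Z"
proof -
  interpret unital_algebra scale by fact
  from infinite_countable_subset[OF inf] obtain x :: "nat \<Rightarrow> 'k" where x: "inj x"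
    by blast
  define X where "X = mat n n (\<lambda>(i, j). if i = j then scale (x i) 1 else 0)"
  \<comment> \<open>On the diagonal this reads \<open>inverse 0 = 0\<close>; any value would do
    there, since the factor \<open>x i - x i\<close> annihilates it.\<close>
  define Y where "Y = mat n n (\<lambda>(i, j). scale (inverse (x i - x j)) (Z $$ (i, j)))"
  have XY: "X \<in> carrier_mat n n" "Y \<in> carrier_mat n n"
    by (simp_all add: X_def Y_def)
  have "Z = X * Y - Y * X"
  proof (rule eq_matI)
    fix i j assume "i < dim_row (X * Y - Y * X)" "j < dim_col (X * Y - Y * X)"
    with XY have ij: "i < n" "j < n" by auto
    have 1: "(X * Y) $$ (i, j) = scale (x i) (Y $$ (i, j))"
      using ij by (subst index_mult_mat_sum[OF XY]) (simp_all add: X_def scale_mult_left if_distrib [of "\<lambda>t. t * _"] cong: if_cong)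
    \<comment> \<open>The scalar now stands to the right of the entry of \<open>Y\<close>;
      \<open>scale_mult_right\<close> pulls it out although \<open>'a\<close> need not be
      commutative.\<close>
    have 2: "(Y * X) $$ (i, j) = scale (x j) (Y $$ (i, j))"
      using ij by (subst index_mult_mat_sum[OF XY(2,1)]) (simp_all add: X_def if_distrib [of "(*) _"] scale_mult_right cong: if_cong)
    have "(X * Y - Y * X) $$ (i, j) = scale (x i - x j) (Y $$ (i, j))"
      using XY ij by (simp add: 1 2 scale_left_diff_distrib del: index_mult_mat(1))
    also have "\<dots> = Z $$ (i, j)"
    proof (cases "i = j")
      case True
      then show ?thesis using Z ij by (simp add: zero_diagonal_def)
    next
      case False
      with x have "x i - x j \<noteq> 0" by (auto dest: injD)
      then show ?thesis using ij by (simp add: Y_def)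
    qed
    finally show "Z $$ (i, j) = (X * Y - Y * X) $$ (i, j)" ..
  qed (use XY Z in auto)
  with XY show ?thesis
    unfolding is_commutator_def mat_commutator_def by blast
qed

lemma upper_triangular_zero_diagonal_factors:
  fixes T :: "'a::{ring, monoid_mult} mat"
  assumes T: "T \<in> carrier_mat n n" "upper_triangular T" and n: "n \<ge> 3"
  obtains C D where "C \<in> carrier_mat n n" "D \<in> carrier_mat n n"
    "zero_diagonal C" "zero_diagonal D" "T = C * D"
proof -
  define m where "m = n - 2"
  \<comment> \<open>\<open>m > 0\<close> keeps the entry \<open>T $$ (0, Suc m)\<close> of
    \<open>C\<close>, at position \<open>(0, m)\<close>, off the diagonal.\<close>
  have m: "n = Suc (Suc m)" "m > 0" using n by (auto simp: m_def)
  define C where "C = mat n n (\<lambda>(i, k).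
    if k = Suc m then (if i = 0 then 1 else 0)
    else if k = m then (if i = 0 then T $$ (0, Suc m)
                        else if i = Suc m then T $$ (Suc m, Suc m) else 0)
    else if i = Suc k then 1 else 0)"
  \<comment> \<open>Indices start at 0. The subdiagonal ones of \<open>C\<close> return the shifted
    rows to their places \<open>1, ..., m\<close>. Row \<open>m\<close> is the freed unit row, and
    row \<open>Suc m\<close> is row 0 of \<open>T\<close> with its last entry deleted.\<close>
  define D where "D = mat n n (\<lambda>(k, j).
    if k = Suc m then (if j = Suc m then 0 else T $$ (0, j))
    else if k = m then (if j = Suc m then 1 else 0)
    else T $$ (Suc k, j))"
  have CD: "C \<in> carrier_mat n n" "D \<in> carrier_mat n n"
    by (simp_all add: C_def D_def)
  have lower_0: "T $$ (i, j) = 0" if "j < i" "i < n" for i j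
    using T that by (auto simp: upper_triangular_def)
  \<comment> \<open>For \<open>k < m\<close> the diagonal entry of \<open>D\<close> is
    \<open>T $$ (Suc k, k)\<close>, just below the diagonal of \<open>T\<close>.\<close>
  have "zero_diagonal C" "zero_diagonal D"
    using m by (auto simp: zero_diagonal_def C_def D_def lower_0)
  moreover have "T = C * D"
  proof (rule eq_matI)
    fix i j assume "i < dim_row (C * D)" "j < dim_col (C * D)"
    with CD have ij: "i < n" "j < n" by auto
    \<comment> \<open>For \<open>i = 0\<close> truncated subtraction gives \<open>i - 1 = 0\<close>,
      so the inner test must discard that term.\<close>
    have "(\<Sum>k<m. C $$ (i, k) * D $$ (k, j)) = (\<Sum>k<m. if k = i - 1 then (if i = 0 then 0 else D $$ (k, j)) else 0)"
      using ij m by (intro sum.cong) (auto simp: C_def)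
    also have "\<dots> = (if 0 < i \<and> i \<le> m then T $$ (i, j) else 0)"
      using ij m by (auto simp: D_def)
    finally have "(C * D) $$ (i, j) = (if 0 < i \<and> i \<le> m then T $$ (i, j) else 0)
        + C $$ (i, m) * D $$ (m, j) + C $$ (i, Suc m) * D $$ (Suc m, j)"
      using ij by (subst index_mult_mat_sum[OF CD]) (simp_all add: m(1))
    also have "\<dots> = T $$ (i, j)"
    proof -
      consider "i = 0" | "0 < i" "i \<le> m" | "i = Suc m"
        using ij m by linarith
      then show ?thesis
        by cases (use ij m lower_0 in \<open>auto simp: C_def D_def\<close>)
    qed
    finally show "T $$ (i, j) = (C * D) $$ (i, j)" ..
  qed (use CD T in auto)
  ultimately show thesis using that CD by blast
qed

theorem theorem3p3:
  fixes scale :: "'k::field \<Rightarrow> 'a::{ring, monoid_mult} \<Rightarrow> 'a"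
    and n :: nat
  assumes "unital_algebra scale"
    and "infinite (UNIV :: 'k set)"
    and "n \<ge> 3"
  shows "(\<forall>T :: 'a mat. T \<in> carrier_mat n n \<and> upper_triangular T \<longrightarrow> product_of_two_commutators n T) \<and>
    (\<forall>T :: 'a mat. T \<in> carrier_mat n n \<and> lower_triangular T \<longrightarrow> product_of_two_commutators n T)"
proof (intro conjI allI impI; elim conjE)
  note comm = is_commutator_zero_diagonal[OF assms(1,2)]
  fix T :: "'a mat"
  assume T: "T \<in> carrier_mat n n"
  {
    assume "upper_triangular T"
    from upper_triangular_zero_diagonal_factors[OF T this assms(3)]
    show "product_of_two_commutators n T"
      unfolding product_of_two_commutators_def by (metis comm)
  }
  {
    assume "lower_triangular T"
    from upper_triangular_zero_diagonal_factors
      [OF rev_mat_carrier[OF T] upper_triangular_rev_mat[OF T this] assms(3)]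
    obtain C D where CD: "C \<in> carrier_mat n n" "D \<in> carrier_mat n n"
      "zero_diagonal C" "zero_diagonal D" and "rev_mat T = C * D" .
    then have "T = rev_mat C * rev_mat D"
      by (metis rev_mat_mult rev_mat_rev_mat)
    with CD show "product_of_two_commutators n T"
      unfolding product_of_two_commutators_def
      by (metis comm rev_mat_carrier zero_diagonal_rev_mat)
  }
qed

end
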